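(* Let $\mathcal{C}$ be any category. The collection of all universal colim sieves on $\mathcal{C}$ (assigning to each object $X$ the collection of universal colim sieves on $X$) forms a Grothendieck topology on $\mathcal{C}$.
   Context: A sieve $S$ on an object $X$ of $\mathcal{C}$ is a collection of morphisms with codomain $X$ closed under precomposition; it is viewed as a full subcategory of the overcategory $(\mathcal{C}\downarrow X)$, and $U\colon S\to\mathcal{C}$ is the forgetful functor $U(f)=\operatorname{domain} f$. For $\alpha\colon Y\to X$, $\alpha^*S=\{g \mid \operatorname{codomain} g=Y,\ \alpha\circ g\in S\}$. A sieve $S$ on $X$ is a colim sieve if $\operatorname{colim}_S U$ exists and the canonical map $\operatorname{colim}_S U\to X$ is an isomorphism (equivalently, $X$ with the maps $f\in S$ is the universal cocone under $U\colon S\to\mathcal{C}$). $S$ is a universal colim sieve if $\alpha^*S$ is a colim sieve on $Y$ for every morphism $\alpha\colon Y\to X$ in $\mathcal{C}$. A Grothendieck topology assigns to each object $X$ a collection $J(X)$ of sieves on $X$ such that: (1) the maximal sieve $(\mathcal{C}\downarrow X)$ is in $J(X)$; (2) if $S\in J(X)$ and $f\colon Y\to X$, then $f^*S\in J(Y)$; (3) if $S\in J(X)$ and $R$ is any sieve on $X$ with $f^*R\in J(\operatorname{domain} f)$ for all $f\in S$, then $R\in J(X)$. *)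

theory Defs
  imports Main
begin

section \<open>Categories and functors\<close>

text \<open>Objects and arrows are explicit carrier sets; the other operations are only meaningful on
  these carriers, and composition only on composable pairs.\<close>

record ('o, 'm) cat =
  obj :: "'o set"
  arr :: "'m set"
  src :: "'m \<Rightarrow> 'o"
  tgt :: "'m \<Rightarrow> 'o"
  idn :: "'o \<Rightarrow> 'm"
  cmp :: "'m \<Rightarrow> 'm \<Rightarrow> 'm"  (infixr \<open>\<cdot>\<index>\<close> 70)

definition hom_set :: "('o, 'm) cat \<Rightarrow> 'o \<Rightarrow> 'o \<Rightarrow> 'm set" where
  "hom_set C X Y = {f \<in> arr C. src C f = X \<and> tgt C f = Y}"

locale category =
  fixes C :: "('o, 'm) cat" (structure)
  assumes src_obj: "f \<in> arr C \<Longrightarrow> src C f \<in> obj C"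
    and tgt_obj: "f \<in> arr C \<Longrightarrow> tgt C f \<in> obj C"
    and idn_hom: "X \<in> obj C \<Longrightarrow> idn C X \<in> hom_set C X X"
    and cmp_hom: "g \<in> hom_set C Y Z \<Longrightarrow> f \<in> hom_set C X Y \<Longrightarrow> g \<cdot> f \<in> hom_set C X Z"
    and cmp_idn_left: "f \<in> hom_set C X Y \<Longrightarrow> idn C Y \<cdot> f = f"
    and cmp_idn_right: "f \<in> hom_set C X Y \<Longrightarrow> f \<cdot> idn C X = f"
    and cmp_assoc: "h \<in> hom_set C Y Z \<Longrightarrow> g \<in> hom_set C X Y \<Longrightarrow> f \<in> hom_set C W X \<Longrightarrow>
      (h \<cdot> g) \<cdot> f = h \<cdot> (g \<cdot> f)"

definition iso_arr :: "('o, 'm) cat \<Rightarrow> 'm \<Rightarrow> bool" where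
  "iso_arr C f \<longleftrightarrow> f \<in> arr C \<and>
    (\<exists>g \<in> hom_set C (tgt C f) (src C f).
      g \<cdot>\<^bsub>C\<^esub> f = idn C (src C f) \<and> f \<cdot>\<^bsub>C\<^esub> g = idn C (tgt C f))"

definition full_subcat :: "('o, 'm) cat \<Rightarrow> 'o set \<Rightarrow> ('o, 'm) cat" where
  "full_subcat C A = C\<lparr>obj := obj C \<inter> A, arr := {f \<in> arr C. src C f \<in> A \<and> tgt C f \<in> A}\<rparr>"

text \<open>In the overcategory of \<open>X\<close>, the triple \<open>(f, h, g)\<close> is the arrow \<open>h\<close> of \<open>C\<close> viewed as a
  morphism from \<open>f\<close> to \<open>g\<close>; the endpoints are recorded because \<open>h\<close> does not determine them.\<close>

definition over_cat :: "('o, 'm) cat \<Rightarrow> 'o \<Rightarrow> ('m, 'm \<times> 'm \<times> 'm) cat" where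
  "over_cat C X =
    \<lparr>obj = {f \<in> arr C. tgt C f = X},
     arr = {(f, h, g). f \<in> arr C \<and> tgt C f = X \<and> g \<in> arr C \<and> tgt C g = X \<and>
              h \<in> hom_set C (src C f) (src C g) \<and> g \<cdot>\<^bsub>C\<^esub> h = f},
     src = (\<lambda>(f, h, g). f),
     tgt = (\<lambda>(f, h, g). g),
     idn = (\<lambda>f. (f, idn C (src C f), f)),
     cmp = (\<lambda>(g', k, e) (f, h, g). (f, k \<cdot>\<^bsub>C\<^esub> h, e))\<rparr>"

record ('i, 'a, 'o, 'm) func =
  obj_map :: "'i \<Rightarrow> 'o"
  arr_map :: "'a \<Rightarrow> 'm"

definition is_functor :: "('i, 'a) cat \<Rightarrow> ('o, 'm) cat \<Rightarrow> ('i, 'a, 'o, 'm) func \<Rightarrow> bool" where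
  "is_functor I C F \<longleftrightarrow> category I \<and> category C \<and>
    (\<forall>i \<in> obj I. obj_map F i \<in> obj C \<and> arr_map F (idn I i) = idn C (obj_map F i)) \<and>
    (\<forall>a \<in> arr I. arr_map F a \<in> hom_set C (obj_map F (src I a)) (obj_map F (tgt I a))) \<and>
    (\<forall>a \<in> arr I. \<forall>b \<in> arr I. tgt I a = src I b \<longrightarrow>
      arr_map F (b \<cdot>\<^bsub>I\<^esub> a) = arr_map F b \<cdot>\<^bsub>C\<^esub> arr_map F a)"


section \<open>Colimits\<close>

definition is_cocone ::
  "('i, 'a) cat \<Rightarrow> ('o, 'm) cat \<Rightarrow> ('i, 'a, 'o, 'm) func \<Rightarrow> 'o \<Rightarrow> ('i \<Rightarrow> 'm) \<Rightarrow> bool" where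
  "is_cocone I C F L \<iota> \<longleftrightarrow> L \<in> obj C \<and>
    (\<forall>i \<in> obj I. \<iota> i \<in> hom_set C (obj_map F i) L) \<and>
    (\<forall>a \<in> arr I. \<iota> (tgt I a) \<cdot>\<^bsub>C\<^esub> arr_map F a = \<iota> (src I a))"

definition is_colimit ::
  "('i, 'a) cat \<Rightarrow> ('o, 'm) cat \<Rightarrow> ('i, 'a, 'o, 'm) func \<Rightarrow> 'o \<Rightarrow> ('i \<Rightarrow> 'm) \<Rightarrow> bool" where
  "is_colimit I C F L \<iota> \<longleftrightarrow> is_functor I C F \<and> is_cocone I C F L \<iota> \<and>
    (\<forall>M \<kappa>. is_cocone I C F M \<kappa> \<longrightarrow>
      (\<exists>!u. u \<in> hom_set C L M \<and> (\<forall>i \<in> obj I. u \<cdot>\<^bsub>C\<^esub> \<iota> i = \<kappa> i)))"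

text \<open>The map out of a colimit \<open>(L, \<iota>)\<close> induced by a cocone \<open>(M, \<kappa>)\<close>.\<close>

definition colimit_desc ::
  "('i, 'a) cat \<Rightarrow> ('o, 'm) cat \<Rightarrow> 'o \<Rightarrow> ('i \<Rightarrow> 'm) \<Rightarrow> 'o \<Rightarrow> ('i \<Rightarrow> 'm) \<Rightarrow> 'm" where
  "colimit_desc I C L \<iota> M \<kappa> =
    (THE u. u \<in> hom_set C L M \<and> (\<forall>i \<in> obj I. u \<cdot>\<^bsub>C\<^esub> \<iota> i = \<kappa> i))"


section \<open>Sieves\<close>

definition is_sieve :: "('o, 'm) cat \<Rightarrow> 'o \<Rightarrow> 'm set \<Rightarrow> bool" where
  "is_sieve C X S \<longleftrightarrow> X \<in> obj C \<and> S \<subseteq> {f \<in> arr C. tgt C f = X} \<and>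
    (\<forall>f \<in> S. \<forall>g \<in> arr C. tgt C g = src C f \<longrightarrow> f \<cdot>\<^bsub>C\<^esub> g \<in> S)"

definition maximal_sieve :: "('o, 'm) cat \<Rightarrow> 'o \<Rightarrow> 'm set" where
  "maximal_sieve C X = {f \<in> arr C. tgt C f = X}"

definition pullback_sieve :: "('o, 'm) cat \<Rightarrow> 'm \<Rightarrow> 'm set \<Rightarrow> 'm set" where
  "pullback_sieve C \<alpha> S = {g \<in> arr C. tgt C g = src C \<alpha> \<and> \<alpha> \<cdot>\<^bsub>C\<^esub> g \<in> S}"

definition sieve_cat :: "('o, 'm) cat \<Rightarrow> 'o \<Rightarrow> 'm set \<Rightarrow> ('m, 'm \<times> 'm \<times> 'm) cat" where
  "sieve_cat C X S = full_subcat (over_cat C X) S"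

definition forgetful :: "('o, 'm) cat \<Rightarrow> ('m, 'm \<times> 'm \<times> 'm, 'o, 'm) func" where
  "forgetful C = \<lparr>obj_map = src C, arr_map = (\<lambda>(f, h, g). h)\<rparr>"

text \<open>The canonical map to \<open>X\<close> is induced by the tautological cocone, whose component at the
  object \<open>f\<close> of \<open>S\<close> is \<open>f\<close> itself.\<close>

definition colim_sieve :: "('o, 'm) cat \<Rightarrow> 'o \<Rightarrow> 'm set \<Rightarrow> bool" where
  "colim_sieve C X S \<longleftrightarrow> is_sieve C X S \<and>
    (\<exists>L \<iota>. is_colimit (sieve_cat C X S) C (forgetful C) L \<iota> \<and>
      iso_arr C (colimit_desc (sieve_cat C X S) C L \<iota> X (\<lambda>f. f)))"

definition universal_colim_sieve :: "('o, 'm) cat \<Rightarrow> 'o \<Rightarrow> 'm set \<Rightarrow> bool" where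
  "universal_colim_sieve C X S \<longleftrightarrow> is_sieve C X S \<and>
    (\<forall>Y \<in> obj C. \<forall>\<alpha> \<in> hom_set C Y X. colim_sieve C Y (pullback_sieve C \<alpha> S))"

definition grothendieck_topology :: "('o, 'm) cat \<Rightarrow> ('o \<Rightarrow> 'm set set) \<Rightarrow> bool" where
  "grothendieck_topology C J \<longleftrightarrow>
    (\<forall>X \<in> obj C. \<forall>S \<in> J X. is_sieve C X S) \<and>
    (\<forall>X \<in> obj C. maximal_sieve C X \<in> J X) \<and>
    (\<forall>X \<in> obj C. \<forall>Y \<in> obj C. \<forall>S \<in> J X. \<forall>f \<in> hom_set C Y X. pullback_sieve C f S \<in> J Y) \<and>
    (\<forall>X \<in> obj C. \<forall>S \<in> J X. \<forall>R. is_sieve C X R \<longrightarrow>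
      (\<forall>f \<in> S. pullback_sieve C f R \<in> J (src C f)) \<longrightarrow> R \<in> J X)"


section \<open>Well-definedness of the constructions\<close>

context category
begin

lemma idn_simps:
  assumes "X \<in> obj C"
  shows "idn C X \<in> arr C" "src C (idn C X) = X" "tgt C (idn C X) = X"
  using idn_hom[OF assms] by (simp_all add: hom_set_def)

lemma cmp_simps:
  assumes "g \<in> arr C" "f \<in> arr C" "tgt C f = src C g"
  shows "g \<cdot> f \<in> arr C" "src C (g \<cdot> f) = src C f" "tgt C (g \<cdot> f) = tgt C g"
  using cmp_hom[of g "src C g" "tgt C g" f "src C f"] assms by (simp_all add: hom_set_def)

lemma unit_simps:
  assumes "f \<in> arr C"
  shows "tgt C f = X \<Longrightarrow> idn C X \<cdot> f = f" "src C f = X \<Longrightarrow> f \<cdot> idn C X = f"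
  using cmp_idn_left[of f "src C f" "tgt C f"] cmp_idn_right[of f "src C f" "tgt C f"] assms
  by (auto simp: hom_set_def)

lemma assoc_simp:
  assumes "h \<in> arr C" "g \<in> arr C" "f \<in> arr C" "tgt C g = src C h" "tgt C f = src C g"
  shows "(h \<cdot> g) \<cdot> f = h \<cdot> (g \<cdot> f)"
  using cmp_assoc[of h "src C h" "tgt C h" g "src C g" f "src C f"] assms
  by (simp add: hom_set_def)

lemma category_full_subcat: "category (full_subcat C A)"
  by (rule category.intro)
    (auto simp: full_subcat_def hom_set_def src_obj tgt_obj idn_simps cmp_simps unit_simps
      assoc_simp)

lemma arr_over_cat_iff:
  "(f, h, g) \<in> arr (over_cat C X) \<longleftrightarrow>
    g \<in> arr C \<and> tgt C g = X \<and> h \<in> arr C \<and> tgt C h = src C g \<and> f = g \<cdot> h"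
  by (auto simp: over_cat_def hom_set_def cmp_simps)

lemma over_cat_simps:
  "f \<in> obj (over_cat C X) \<longleftrightarrow> f \<in> arr C \<and> tgt C f = X"
  "src (over_cat C X) (f, h, g) = f"
  "tgt (over_cat C X) (f, h, g) = g"
  "idn (over_cat C X) f = (f, idn C (src C f), f)"
  "(g', k, e) \<cdot>\<^bsub>over_cat C X\<^esub> (f, h, g) = (f, k \<cdot> h, e)"
  by (simp_all add: over_cat_def)

lemma category_over_cat: "category (over_cat C X)"
  by (rule category.intro)
    (auto simp: arr_over_cat_iff over_cat_simps hom_set_def src_obj tgt_obj idn_simps cmp_simps
      unit_simps assoc_simp)

lemma is_functor_forgetful: "is_functor (sieve_cat C X S) C (forgetful C)"
proof -
  have "category (sieve_cat C X S)"
    unfolding sieve_cat_def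
    by (intro category.category_full_subcat category_over_cat)
  then show ?thesis
    using category_axioms src_obj
    by (auto simp: is_functor_def forgetful_def sieve_cat_def full_subcat_def over_cat_def)
qed

end

end

(* S is a colim sieve iff every representable presheaf satisfies the sheaf condition for S.  For
   transitivity, a matching family on R is glued locally on the pullbacks of R along the members
   of S, and the local gluings form a matching family on S that glues to u.  That u restricts
   correctly along a member r of R (which need not lie in S) is checked on the pullback of S
   along r; this is where universality of S enters. *)

theory Submission
  imports Defs
begin

text \<open>A matching family on \<open>S\<close> for the presheaf represented by \<open>M\<close>.
  The compatibility is indexed by pairs \<open>f\<close>, \<open>h\<close> rather than by arrows of
  \<open>sieve_cat\<close>, so the colimit formalism is left behind once
  \<open>colim_sieve_iff\<close> is available.\<close>

definition matching_family :: "('o, 'm) cat \<Rightarrow> 'm set \<Rightarrow> 'o \<Rightarrow> ('m \<Rightarrow> 'm) \<Rightarrow> bool" where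
  "matching_family C S M \<kappa> \<longleftrightarrow>
    (\<forall>f \<in> S. \<kappa> f \<in> hom_set C (src C f) M) \<and>
    (\<forall>f \<in> S. \<forall>h \<in> arr C. tgt C h = src C f \<longrightarrow> \<kappa> (f \<cdot>\<^bsub>C\<^esub> h) = \<kappa> f \<cdot>\<^bsub>C\<^esub> h)"

definition amalgamation :: "('o, 'm) cat \<Rightarrow> 'o \<Rightarrow> 'm set \<Rightarrow> 'o \<Rightarrow> ('m \<Rightarrow> 'm) \<Rightarrow> 'm \<Rightarrow> bool" where
  "amalgamation C X S M \<kappa> u \<longleftrightarrow> u \<in> hom_set C X M \<and> (\<forall>f \<in> S. u \<cdot>\<^bsub>C\<^esub> f = \<kappa> f)"

lemma sieve_closed:
  "is_sieve C X S \<Longrightarrow> f \<in> S \<Longrightarrow> h \<in> arr C \<Longrightarrow> tgt C h = src C f \<Longrightarrow> f \<cdot>\<^bsub>C\<^esub> h \<in> S"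
  by (simp add: is_sieve_def)

lemma sieve_arr:
  "is_sieve C X S \<Longrightarrow> f \<in> S \<Longrightarrow> f \<in> arr C \<and> tgt C f = X"
  by (auto simp: is_sieve_def)

context category
begin

section \<open>Pullbacks of sieves\<close>

lemma is_sieve_pullback:
  assumes "is_sieve C X S" "\<alpha> \<in> hom_set C Y X"
  shows "is_sieve C Y (pullback_sieve C \<alpha> S)"
  using assms
  by (auto simp: is_sieve_def pullback_sieve_def hom_set_def src_obj cmp_simps
      assoc_simp[symmetric])

lemma pullback_pullback:
  assumes "\<alpha> \<in> hom_set C Y X" "g \<in> arr C" "tgt C g = Y"
  shows "pullback_sieve C g (pullback_sieve C \<alpha> S) = pullback_sieve C (\<alpha> \<cdot> g) S"
  using assms by (auto simp: pullback_sieve_def hom_set_def cmp_simps assoc_simp)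

lemma pullback_idn:
  assumes "is_sieve C X S"
  shows "pullback_sieve C (idn C X) S = S"
  using assms by (auto simp: pullback_sieve_def is_sieve_def idn_simps unit_simps)

section \<open>Colimits over a sieve as a gluing condition\<close>

lemma obj_sieve_cat:
  assumes "is_sieve C X S"
  shows "obj (sieve_cat C X S) = S"
  using assms by (auto simp: sieve_cat_def full_subcat_def over_cat_def is_sieve_def)

text \<open>An arrow \<open>(f, h, g)\<close> of the sieve category amounts to a free choice of
  \<open>g\<close> in \<open>S\<close> and \<open>h\<close> into its source: \<open>f\<close> must
  be \<open>g \<cdot> h\<close>, which stays in \<open>S\<close> by closure. Naturality of a cocone
  thus becomes compatibility with precomposition.\<close>

lemma is_cocone_sieve_iff:
  assumes "is_sieve C X S"
  shows "is_cocone (sieve_cat C X S) C (forgetful C) M \<kappa> \<longleftrightarrow>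
    M \<in> obj C \<and> matching_family C S M \<kappa>"
proof -
  have arrs: "(f, h, g) \<in> arr (sieve_cat C X S) \<longleftrightarrow>
      g \<in> S \<and> h \<in> arr C \<and> tgt C h = src C g \<and> f = g \<cdot> h" for f h g
    using assms sieve_arr[OF assms, of g] sieve_closed[OF assms, of g h]
    by (auto simp: sieve_cat_def full_subcat_def arr_over_cat_iff over_cat_simps)
  have "src (sieve_cat C X S) (f, h, g) = f" "tgt (sieve_cat C X S) (f, h, g) = g" for f h g
    by (simp_all add: sieve_cat_def full_subcat_def over_cat_simps)
  then show ?thesis
    unfolding is_cocone_def matching_family_def forgetful_def obj_sieve_cat[OF assms]
      Ball_def split_paired_All
    by (auto simp: arrs)
qed

lemma is_colimit_sieve_iff:
  assumes "is_sieve C X S"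
  shows "is_colimit (sieve_cat C X S) C (forgetful C) L \<iota> \<longleftrightarrow>
    L \<in> obj C \<and> matching_family C S L \<iota> \<and>
    (\<forall>M \<in> obj C. \<forall>\<kappa>. matching_family C S M \<kappa> \<longrightarrow>
      (\<exists>!u. u \<in> hom_set C L M \<and> (\<forall>f \<in> S. u \<cdot> \<iota> f = \<kappa> f)))"
  unfolding is_colimit_def is_cocone_sieve_iff[OF assms] obj_sieve_cat[OF assms]
  by (simp add: is_functor_forgetful Ball_def imp_conjL)

lemma matching_family_taut:
  assumes "is_sieve C X S"
  shows "matching_family C S X (\<lambda>f. f)"
  using sieve_arr[OF assms] by (auto simp: matching_family_def hom_set_def)

text \<open>Forwards, the universal property of some colimit \<open>L\<close> is transported to
  \<open>X\<close> along the inverse of the canonical map. Backwards, \<open>X\<close> with the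
  tautological cocone is itself a colimit, and its canonical map is the identity.\<close>

lemma colim_sieve_iff:
  "colim_sieve C X S \<longleftrightarrow> is_sieve C X S \<and>
    (\<forall>M \<in> obj C. \<forall>\<kappa>. matching_family C S M \<kappa> \<longrightarrow> (\<exists>!u. amalgamation C X S M \<kappa> u))"
proof (cases "is_sieve C X S")
  case True
  note S = sieve_arr[OF True]
  have X: "X \<in> obj C"
    using True by (simp add: is_sieve_def)
  note objs = obj_sieve_cat[OF True]
  show ?thesis
  proof
    assume "colim_sieve C X S"
    then obtain L \<iota> where
      col: "is_colimit (sieve_cat C X S) C (forgetful C) L \<iota>" and
      iso: "iso_arr C (colimit_desc (sieve_cat C X S) C L \<iota> X (\<lambda>f. f))"
      by (auto simp: colim_sieve_def)
    define c where "c = colimit_desc (sieve_cat C X S) C L \<iota> X (\<lambda>f. f)"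
    have \<iota>: "\<iota> f \<in> arr C" "tgt C (\<iota> f) = L" "src C (\<iota> f) = src C f" if "f \<in> S" for f
      using col that by (auto simp: is_colimit_sieve_iff[OF True] matching_family_def hom_set_def)
    have ex1: "\<exists>!u. u \<in> hom_set C L M \<and> (\<forall>f \<in> S. u \<cdot> \<iota> f = \<kappa> f)"
      if "M \<in> obj C" "matching_family C S M \<kappa>" for M \<kappa>
      using col that by (simp add: is_colimit_sieve_iff[OF True])
    have c: "c \<in> hom_set C L X" "\<And>f. f \<in> S \<Longrightarrow> c \<cdot> \<iota> f = f"
      using theI'[OF ex1[OF X matching_family_taut[OF True]]]
      by (auto simp: c_def colimit_desc_def objs)
    \<comment> \<open>\<open>d\<close> is the inverse of the canonical map \<open>c\<close>; a map
      \<open>u\<close> out of \<open>L\<close> becomes the map \<open>u \<cdot> d\<close> out of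
      \<open>X\<close>.\<close>
    obtain d where d: "d \<in> hom_set C X L" "d \<cdot> c = idn C L" "c \<cdot> d = idn C X"
      using iso c(1) unfolding c_def[symmetric] by (auto simp: iso_arr_def hom_set_def)
    have "\<exists>!u. amalgamation C X S M \<kappa> u" if M: "M \<in> obj C" "matching_family C S M \<kappa>" for M \<kappa>
    proof -
      obtain u where u: "u \<in> hom_set C L M" "\<And>f. f \<in> S \<Longrightarrow> u \<cdot> \<iota> f = \<kappa> f"
        using ex1[OF M] by blast
      \<comment> \<open>Cancel \<open>d \<cdot> c\<close> in
        \<open>d \<cdot> (c \<cdot> \<iota> f)\<close>, where
        \<open>c \<cdot> \<iota> f = f\<close>.\<close>
      have d\<iota>: "d \<cdot> f = \<iota> f" if "f \<in> S" for f
        using assoc_simp[of d c "\<iota> f"] c c(2)[OF that] d \<iota>[OF that]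
        by (simp add: hom_set_def unit_simps)
      show ?thesis
      proof (rule ex1I)
        show "amalgamation C X S M \<kappa> (u \<cdot> d)"
          unfolding amalgamation_def
        proof (intro conjI ballI)
          show "u \<cdot> d \<in> hom_set C X M"
            using cmp_hom[OF u(1) d(1)] .
          fix f assume f: "f \<in> S"
          show "(u \<cdot> d) \<cdot> f = \<kappa> f"
            using u d S[OF f] f by (simp add: hom_set_def assoc_simp d\<iota>)
        qed
      next
        fix v assume v: "amalgamation C X S M \<kappa> v"
        then have vX: "v \<in> hom_set C X M"
          by (simp add: amalgamation_def)
        \<comment> \<open>Uniqueness is pulled back to \<open>L\<close>: \<open>v \<cdot> c\<close>
          factors the same family through \<open>\<iota>\<close>, so it equals \<open>u\<close>, and
          composing with \<open>d\<close> recovers \<open>v\<close>.\<close>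
        have "v \<cdot> c \<in> hom_set C L M"
          using cmp_hom[OF vX c(1)] .
        moreover have "(v \<cdot> c) \<cdot> \<iota> f = \<kappa> f" if f: "f \<in> S" for f
          using v c \<iota>[OF f] f by (simp add: amalgamation_def hom_set_def assoc_simp)
        ultimately have "v \<cdot> c = u"
          using ex1[OF M] u by blast
        then show "v = u \<cdot> d"
          using assoc_simp[of v c d] vX c(1) d by (simp add: hom_set_def unit_simps)
      qed
    qed
    then show "is_sieve C X S \<and>
      (\<forall>M \<in> obj C. \<forall>\<kappa>. matching_family C S M \<kappa> \<longrightarrow> (\<exists>!u. amalgamation C X S M \<kappa> u))"
      using True by blast
  next
    assume R: "is_sieve C X S \<and>
      (\<forall>M \<in> obj C. \<forall>\<kappa>. matching_family C S M \<kappa> \<longrightarrow> (\<exists>!u. amalgamation C X S M \<kappa> u))"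
    then have "is_colimit (sieve_cat C X S) C (forgetful C) X (\<lambda>f. f)"
      using X matching_family_taut[OF True]
      by (simp add: is_colimit_sieve_iff[OF True] amalgamation_def)
    \<comment> \<open>The identity factors the tautological cocone through itself, so by uniqueness
      it is the canonical map.\<close>
    moreover have "colimit_desc (sieve_cat C X S) C X (\<lambda>f. f) X (\<lambda>f. f) = idn C X"
      unfolding colimit_desc_def objs
    proof (rule the1_equality)
      show "\<exists>!u. u \<in> hom_set C X X \<and> (\<forall>f \<in> S. u \<cdot> f = f)"
        using R X matching_family_taut[OF True] unfolding amalgamation_def by blast
      show "idn C X \<in> hom_set C X X \<and> (\<forall>f \<in> S. idn C X \<cdot> f = f)"
        using S idn_hom[OF X] by (simp add: unit_simps)
    qed
    moreover have "iso_arr C (idn C X)"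
      using idn_simps[OF X] idn_hom[OF X] unit_simps(1)[OF idn_simps(1)[OF X]]
      by (auto simp: iso_arr_def)
    ultimately show "colim_sieve C X S"
      unfolding colim_sieve_def using True
      by (intro conjI exI[of _ X] exI[of _ "\<lambda>f. f"]) simp_all
  qed
qed (simp add: colim_sieve_def)

section \<open>Gluing maps and testing equality on a colim sieve\<close>

lemma colim_sieve_ex:
  assumes "colim_sieve C X S" "M \<in> obj C" "matching_family C S M \<kappa>"
  obtains u where "u \<in> hom_set C X M" "\<And>f. f \<in> S \<Longrightarrow> u \<cdot> f = \<kappa> f"
  using assms unfolding colim_sieve_iff amalgamation_def by blast

text \<open>The members of a colim sieve are jointly epic: \<open>u\<close> and \<open>v\<close>
  both amalgamate the family obtained by restricting \<open>v\<close>.\<close>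

lemma colim_sieve_eqI:
  assumes S: "colim_sieve C X S"
    and u: "u \<in> hom_set C X M" and v: "v \<in> hom_set C X M"
    and eq: "\<And>f. f \<in> S \<Longrightarrow> u \<cdot> f = v \<cdot> f"
  shows "u = v"
proof -
  have sv: "is_sieve C X S"
    using S by (simp add: colim_sieve_def)
  have "M \<in> obj C"
    using u tgt_obj by (auto simp: hom_set_def)
  moreover have "matching_family C S M (\<lambda>f. v \<cdot> f)"
    using v sieve_arr[OF sv] by (auto simp: matching_family_def hom_set_def cmp_simps assoc_simp)
  moreover have "amalgamation C X S M (\<lambda>f. v \<cdot> f) u" "amalgamation C X S M (\<lambda>f. v \<cdot> f) v"
    using u v eq by (auto simp: amalgamation_def)
  ultimately show ?thesis
    using S unfolding colim_sieve_iff by blast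
qed

section \<open>Maximal sieves and stability under pullback\<close>

text \<open>The Yoneda argument: the maximal sieve contains the identity, so a matching family is
  determined by its value there, and that value is the amalgamation.\<close>

lemma colim_sieve_maximal:
  assumes X: "X \<in> obj C"
  shows "colim_sieve C X (maximal_sieve C X)"
  unfolding colim_sieve_iff
proof (intro conjI ballI allI impI)
  show "is_sieve C X (maximal_sieve C X)"
    using X by (auto simp: is_sieve_def maximal_sieve_def cmp_simps)
  fix M \<kappa> assume "M \<in> obj C" and \<kappa>: "matching_family C (maximal_sieve C X) M \<kappa>"
  have idn: "idn C X \<in> maximal_sieve C X"
    using idn_simps[OF X] by (simp add: maximal_sieve_def)
  show "\<exists>!u. amalgamation C X (maximal_sieve C X) M \<kappa> u"
  proof (rule ex1I)
    have "\<kappa> (idn C X) \<in> hom_set C X M"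
      using \<kappa> idn idn_simps[OF X] by (auto simp: matching_family_def)
    moreover have "\<kappa> (idn C X) \<cdot> f = \<kappa> f" if "f \<in> maximal_sieve C X" for f
    proof -
      have "\<kappa> (idn C X \<cdot> f) = \<kappa> (idn C X) \<cdot> f"
        using \<kappa> idn idn_simps[OF X] that by (auto simp: matching_family_def maximal_sieve_def)
      then show ?thesis
        using that by (simp add: maximal_sieve_def unit_simps)
    qed
    ultimately show "amalgamation C X (maximal_sieve C X) M \<kappa> (\<kappa> (idn C X))"
      by (simp add: amalgamation_def)
    fix v assume "amalgamation C X (maximal_sieve C X) M \<kappa> v"
    then have "v \<cdot> idn C X = \<kappa> (idn C X)" "v \<in> hom_set C X M"
      using idn by (auto simp: amalgamation_def)
    then show "v = \<kappa> (idn C X)"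
      by (simp add: hom_set_def unit_simps)
  qed
qed

lemma universal_colim_sieve_maximal:
  assumes "X \<in> obj C"
  shows "universal_colim_sieve C X (maximal_sieve C X)"
proof -
  have "pullback_sieve C \<alpha> (maximal_sieve C X) = maximal_sieve C Y"
    if "\<alpha> \<in> hom_set C Y X" for \<alpha> Y
    using that by (auto simp: pullback_sieve_def maximal_sieve_def hom_set_def cmp_simps)
  then show ?thesis
    using colim_sieve_maximal assms by (auto simp: universal_colim_sieve_def colim_sieve_def)
qed

text \<open>Pulling back along \<alpha> and then \<beta> is pulling back along their composite,
  which universality of \<open>S\<close> already covers.\<close>

lemma universal_colim_sieve_pullback:
  assumes S: "universal_colim_sieve C X S" and \<alpha>: "\<alpha> \<in> hom_set C Y X"
  shows "universal_colim_sieve C Y (pullback_sieve C \<alpha> S)"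
  unfolding universal_colim_sieve_def
proof (intro conjI ballI)
  show "is_sieve C Y (pullback_sieve C \<alpha> S)"
    using S \<alpha> is_sieve_pullback unfolding universal_colim_sieve_def by blast
  fix Z \<beta> assume "Z \<in> obj C" and \<beta>: "\<beta> \<in> hom_set C Z Y"
  moreover have "pullback_sieve C \<beta> (pullback_sieve C \<alpha> S) = pullback_sieve C (\<alpha> \<cdot> \<beta>) S"
    using pullback_pullback[OF \<alpha>] \<beta> by (simp add: hom_set_def)
  ultimately show "colim_sieve C Z (pullback_sieve C \<beta> (pullback_sieve C \<alpha> S))"
    using S cmp_hom[OF \<alpha> \<beta>] by (simp add: universal_colim_sieve_def)
qed

text \<open>The instance of universality at the identity of \<open>X\<close>.\<close>

lemma colim_sieve_if_universal:
  assumes "universal_colim_sieve C X S"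
  shows "colim_sieve C X S"
proof -
  have "is_sieve C X S" "X \<in> obj C"
    using assms by (auto simp: universal_colim_sieve_def is_sieve_def)
  then show ?thesis
    using assms pullback_idn idn_hom by (metis universal_colim_sieve_def)
qed

lemma colim_sieve_pullback:
  assumes "universal_colim_sieve C X S" "f \<in> hom_set C Y X"
  shows "colim_sieve C Y (pullback_sieve C f S)"
  using assms by (intro colim_sieve_if_universal universal_colim_sieve_pullback)

section \<open>Transitivity\<close>

lemma matching_family_pullback:
  assumes "is_sieve C X R" "matching_family C R M \<kappa>" "f \<in> hom_set C Y X"
  shows "matching_family C (pullback_sieve C f R) M (\<lambda>g. \<kappa> (f \<cdot> g))"
  using assms
  by (auto simp: matching_family_def pullback_sieve_def hom_set_def cmp_simps
      assoc_simp[symmetric])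

text \<open>The pullbacks of \<open>R\<close> are assumed to be plain colim sieves while
  \<open>S\<close> is universal; the universal version follows by applying this after each base
  change.\<close>

lemma colim_sieve_local:
  assumes S: "universal_colim_sieve C X S" and R: "is_sieve C X R"
    and loc: "\<And>f. f \<in> S \<Longrightarrow> colim_sieve C (src C f) (pullback_sieve C f R)"
  shows "colim_sieve C X R"
  unfolding colim_sieve_iff
proof (intro conjI ballI allI impI)
  fix M \<kappa> assume M: "M \<in> obj C" and \<kappa>: "matching_family C R M \<kappa>"
  have sv: "is_sieve C X S"
    using S by (simp add: universal_colim_sieve_def)
  have hom: "f \<in> arr C" "tgt C f = X" "f \<in> hom_set C (src C f) X" if "f \<in> S \<or> f \<in> R" for f
    using that sieve_arr[OF sv] sieve_arr[OF R] by (auto simp: hom_set_def)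
  have "\<exists>w. w \<in> hom_set C (src C f) M \<and> (\<forall>g \<in> pullback_sieve C f R. w \<cdot> g = \<kappa> (f \<cdot> g))"
    if "f \<in> S" for f
  proof -
    have "matching_family C (pullback_sieve C f R) M (\<lambda>g. \<kappa> (f \<cdot> g))"
      using matching_family_pullback[OF R \<kappa> hom(3)] that by simp
    from colim_sieve_ex[OF loc[OF that] M this] show ?thesis
      by metis
  qed
  \<comment> \<open>\<open>w f\<close> is the local gluing of \<kappa> over the source of
    \<open>f\<close>.\<close>
  then obtain w where w: "\<And>f. f \<in> S \<Longrightarrow> w f \<in> hom_set C (src C f) M"
    and w_eq: "\<And>f g. f \<in> S \<Longrightarrow> g \<in> pullback_sieve C f R \<Longrightarrow> w f \<cdot> g = \<kappa> (f \<cdot> g)"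
    by metis
  \<comment> \<open>Compatibility of the local gluings is tested on the pullback of \<open>R\<close>
    along \<open>f \<cdot> h\<close>: restricted along a member \<open>g\<close>, both sides give
    \<open>\<kappa> (f \<cdot> (h \<cdot> g))\<close>.\<close>
  have "w (f \<cdot> h) = w f \<cdot> h" if f: "f \<in> S" and h: "h \<in> arr C" "tgt C h = src C f" for f h
  proof (rule colim_sieve_eqI)
    have fh: "f \<cdot> h \<in> S"
      using sieve_closed[OF sv f h] .
    have src: "src C (f \<cdot> h) = src C h"
      using cmp_simps hom f h by simp
    show "colim_sieve C (src C h) (pullback_sieve C (f \<cdot> h) R)"
      using loc[OF fh] src by simp
    show "w (f \<cdot> h) \<in> hom_set C (src C h) M"
      using w[OF fh] src by simp
    show "w f \<cdot> h \<in> hom_set C (src C h) M"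
      using cmp_hom[OF w[OF f]] h by (simp add: hom_set_def)
    fix g assume g: "g \<in> pullback_sieve C (f \<cdot> h) R"
    then have g': "g \<in> arr C" "tgt C g = src C h"
      using src by (auto simp: pullback_sieve_def)
    have assoc: "(f \<cdot> h) \<cdot> g = f \<cdot> (h \<cdot> g)"
      using assoc_simp hom f h g' by simp
    have hg: "h \<cdot> g \<in> pullback_sieve C f R"
      using g g' h assoc by (simp add: pullback_sieve_def cmp_simps)
    have "w (f \<cdot> h) \<cdot> g = w f \<cdot> (h \<cdot> g)"
      using w_eq[OF fh g] w_eq[OF f hg] assoc by simp
    also have "\<dots> = (w f \<cdot> h) \<cdot> g"
      using w[OF f] h g' by (simp add: hom_set_def assoc_simp)
    finally show "w (f \<cdot> h) \<cdot> g = (w f \<cdot> h) \<cdot> g" .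
  qed
  then have mw: "matching_family C S M w"
    using w by (simp add: matching_family_def)
  obtain u where u: "u \<in> hom_set C X M" "\<And>f. f \<in> S \<Longrightarrow> u \<cdot> f = w f"
    using colim_sieve_ex[OF colim_sieve_if_universal[OF S] M mw] by metis
  \<comment> \<open>When \<open>f\<close> lies in \<open>R\<close> as well, the pullback of
    \<open>R\<close> along \<open>f\<close> contains the identity, and evaluating \<open>w f\<close>
    there gives \<open>\<kappa> f\<close>.\<close>
  have w_\<kappa>: "w f = \<kappa> f" if f: "f \<in> S" "f \<in> R" for f
  proof -
    have [simp]: "f \<cdot> idn C (src C f) = f"
      using hom f by (simp add: unit_simps)
    have "idn C (src C f) \<in> pullback_sieve C f R"
      using f hom idn_simps[OF src_obj[of f]] by (simp add: pullback_sieve_def)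
    from w_eq[OF f(1) this] show ?thesis
      using w[OF f(1)] by (simp add: hom_set_def unit_simps)
  qed
  \<comment> \<open>For \<open>g\<close> in the pullback of \<open>S\<close> along \<open>r\<close>,
    the composite \<open>r \<cdot> g\<close> lies in both sieves, so \<open>w_\<kappa>\<close>
    applies to it.\<close>
  have u_\<kappa>: "u \<cdot> r = \<kappa> r" if r: "r \<in> R" for r
  proof (rule colim_sieve_eqI)
    note r' = hom[OF disjI2[OF r]]
    show "colim_sieve C (src C r) (pullback_sieve C r S)"
      using colim_sieve_pullback[OF S r'(3)] .
    show "u \<cdot> r \<in> hom_set C (src C r) M"
      using cmp_hom[OF u(1) r'(3)] .
    show "\<kappa> r \<in> hom_set C (src C r) M"
      using \<kappa> r by (simp add: matching_family_def)
    fix g assume "g \<in> pullback_sieve C r S"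
    then have g: "g \<in> arr C" "tgt C g = src C r" "r \<cdot> g \<in> S"
      by (auto simp: pullback_sieve_def)
    have "(u \<cdot> r) \<cdot> g = u \<cdot> (r \<cdot> g)"
      using u(1) r' g by (simp add: hom_set_def assoc_simp)
    also have "\<dots> = \<kappa> (r \<cdot> g)"
      using u(2)[OF g(3)] w_\<kappa>[OF g(3)] sieve_closed[OF R r g(1,2)] by simp
    also have "\<dots> = \<kappa> r \<cdot> g"
      using \<kappa> r g by (simp add: matching_family_def)
    finally show "(u \<cdot> r) \<cdot> g = \<kappa> r \<cdot> g" .
  qed
  show "\<exists>!u. amalgamation C X R M \<kappa> u"
  proof (rule ex1I)
    show "amalgamation C X R M \<kappa> u"
      using u(1) u_\<kappa> by (simp add: amalgamation_def)
    fix v assume v: "amalgamation C X R M \<kappa> v"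
    then have vX: "v \<in> hom_set C X M"
      by (simp add: amalgamation_def)
    \<comment> \<open>Equality is tested in two layers: first along each \<open>f\<close> in
      \<open>S\<close>, then along the pullback of \<open>R\<close> along \<open>f\<close>, whose
      members land in \<open>R\<close>, where both maps restrict to \<kappa>.\<close>
    show "v = u"
    proof (rule colim_sieve_eqI[OF colim_sieve_if_universal[OF S] vX u(1)])
      fix f assume f: "f \<in> S"
      note f' = hom[OF disjI1[OF f]]
      show "v \<cdot> f = u \<cdot> f"
      proof (rule colim_sieve_eqI[OF loc[OF f] cmp_hom[OF vX f'(3)] cmp_hom[OF u(1) f'(3)]])
        fix g assume "g \<in> pullback_sieve C f R"
        then have "g \<in> arr C" "tgt C g = src C f" "f \<cdot> g \<in> R"
          by (auto simp: pullback_sieve_def)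
        then show "(v \<cdot> f) \<cdot> g = (u \<cdot> f) \<cdot> g"
          using u(1) vX v f' u_\<kappa> by (simp add: hom_set_def assoc_simp amalgamation_def)
      qed
    qed
  qed
qed (rule R)

text \<open>All data are base-changed along \<alpha>. A member \<open>g\<close> of the pulled-back
  \<open>S\<close> has \<open>\<alpha> \<cdot> g\<close> in \<open>S\<close>, and pulling
  \<open>R\<close> back along \<alpha> and then \<open>g\<close> is pulling it back along
  \<open>\<alpha> \<cdot> g\<close>, so the local hypothesis carries over.\<close>

lemma universal_colim_sieve_local:
  assumes S: "universal_colim_sieve C X S" and R: "is_sieve C X R"
    and loc: "\<And>f. f \<in> S \<Longrightarrow> universal_colim_sieve C (src C f) (pullback_sieve C f R)"
  shows "universal_colim_sieve C X R"
  unfolding universal_colim_sieve_def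
proof (intro conjI ballI)
  fix Y \<alpha> assume \<alpha>: "\<alpha> \<in> hom_set C Y X"
  show "colim_sieve C Y (pullback_sieve C \<alpha> R)"
  proof (rule colim_sieve_local)
    show "universal_colim_sieve C Y (pullback_sieve C \<alpha> S)"
      using universal_colim_sieve_pullback[OF S \<alpha>] .
    show "is_sieve C Y (pullback_sieve C \<alpha> R)"
      using is_sieve_pullback[OF R \<alpha>] .
    fix g assume "g \<in> pullback_sieve C \<alpha> S"
    then have g: "g \<in> arr C" "tgt C g = Y" "\<alpha> \<cdot> g \<in> S"
      using \<alpha> by (auto simp: pullback_sieve_def hom_set_def)
    moreover have "src C (\<alpha> \<cdot> g) = src C g"
      using \<alpha> g by (simp add: hom_set_def cmp_simps)
    ultimately show "colim_sieve C (src C g) (pullback_sieve C g (pullback_sieve C \<alpha> R))"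
      using colim_sieve_if_universal[OF loc[OF g(3)]] pullback_pullback[OF \<alpha>] by simp
  qed
qed (rule R)

end

theorem theorem5p4:
  fixes C :: "('o, 'm) cat"
  assumes "category C"
  shows "grothendieck_topology C (\<lambda>X. {S. universal_colim_sieve C X S})"
proof -
  interpret category C by (rule assms)
  show ?thesis
    unfolding grothendieck_topology_def mem_Collect_eq
  proof (intro conjI ballI allI impI)
    fix X S assume "S \<in> {S. universal_colim_sieve C X S}"
    then show "is_sieve C X S"
      by (simp add: universal_colim_sieve_def)
  next
    fix X S R
    assume "S \<in> {S. universal_colim_sieve C X S}" "is_sieve C X R"
      "\<forall>f \<in> S. universal_colim_sieve C (src C f) (pullback_sieve C f R)"
    then show "universal_colim_sieve C X R"
      using universal_colim_sieve_local[of X S R] by simp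
  qed (simp_all add: universal_colim_sieve_maximal universal_colim_sieve_pullback)
qed

end
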